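(* Let $k\ge 2$ be an integer and let $S\in V_k$ be a (non-faulty) root node of the dense Gaussian network $G_k$. Consider the parallel construction procedure described in the context, started from $S$. (a) If there are no faulty nodes, then the procedure constructs the four trees (that is, every node other than $S$ receives the packet and hence determines its parent and children in each of the four trees rooted at $S$) and terminates in $k+1$ steps: every node other than $S$ receives the packet in at most $k$ steps, and the last packets are sent in step $k+1$. (b) If there are one, two or three faulty nodes, all different from $S$, then for every non-faulty node $v\neq S$ at least one of the four trees rooted at $S$ has a path from $S$ to $v$ containing no faulty node, every non-faulty node $v\ne S$ receives the packet in at most $2k$ steps, and the procedure terminates in at most $2k+1$ steps.
   Context: For an integer $k\ge 2$ let $\alpha_k=k+(k+1)i\in\mathbb{Z}[i]$. The dense Gaussian network $G_k=(V_k,E_k)$ is the undirected graph with node set $V_k=\{x+yi : x,y\in\mathbb{Z},\ |x|+|y|\le k\}$ (a complete system of representatives of $\mathbb{Z}[i]$ modulo $\alpha_k$), in which two nodes $A,B$ are adjacent if and only if $A-B$ is congruent modulo $\alpha_k$ to one of $1,-1,i,-i$. For $z\in\mathbb{Z}[i]$, $z \bmod \alpha_k$ denotes the unique element of $V_k$ congruent to $z$ modulo $\alpha_k$. All edges are regarded as undirected. The four trees. Let $E_k^V=\{(v,(v+i)\bmod\alpha_k) : v\in V_k\}$. Define $$\begin{aligned}E_k^{(1)}=\Big(E_k^V&\setminus\big(\{(qi,(q+1)i): 0\le q\le k-1\}\cup\{(q-i,q): -k+1\le q\le 0\}\cup\{(-k,ki)\}\big)\Big)\\&\cup\{(q,q+1):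 0\le q\le k-1\}\cup\{(-1+qi,qi): 1\le q\le k-1\}\cup\{(k,ki)\},\end{aligned}$$ and $T_k^{(1)}=(V_k,E_k^{(1)})$. Let $\rho(x+yi)=-y+xi$ on $V_k$, extended to edges and subgraphs, and $T_k^{(j)}=\rho^{\,j-1}(T_k^{(1)})$ for $j=2,3,4$. These are spanning trees of $G_k$ rooted at $0$. The four trees rooted at $S$ are the images of $T_k^{(1)},\dots,T_k^{(4)}$ under the automorphism $x\mapsto (x+S)\bmod\alpha_k$ of $G_k$. The procedure. Time proceeds in synchronous steps; in one step each node can simultaneously send on and receive from all of its edges. In step $1$ the root $S$ sends a packet containing its address to its four neighbors. When a non-faulty node other than $S$ receives the packet for the first time, in step $t$ say, it computes its address relative to $S$, i.e. $(v-S)\bmod\alpha_k$, determines from this its parent and children in each of the four trees rooted at $S$, and in step $t+1$ forwards the packet to all its neighbors except the one from which it (first) received the packet (if several copies arrive in the same step, one of them is treated as the first). All later copies of the packet are ignored. The root $S$ ignores all packets it receives. Faulty nodes never send anything. The procedure terminates after the last step in which some packet is sent. *)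

theory Defs
  imports Main
begin

section \<open>Gaussian integers\<close>

datatype gauss_int = Gauss_Int (ReZ: int) (ImZ: int)

lemma gauss_int_eq_iff: "z = w \<longleftrightarrow> ReZ z = ReZ w \<and> ImZ z = ImZ w"
  by (cases z; cases w) auto

instantiation gauss_int :: comm_ring_1
begin

definition zero_gauss_int :: gauss_int where "0 = Gauss_Int 0 0"
definition one_gauss_int :: gauss_int where "1 = Gauss_Int 1 0"
definition plus_gauss_int :: "gauss_int \<Rightarrow> gauss_int \<Rightarrow> gauss_int" where
  "z + w = Gauss_Int (ReZ z + ReZ w) (ImZ z + ImZ w)"
definition uminus_gauss_int :: "gauss_int \<Rightarrow> gauss_int" where
  "- z = Gauss_Int (- ReZ z) (- ImZ z)"
definition minus_gauss_int :: "gauss_int \<Rightarrow> gauss_int \<Rightarrow> gauss_int" where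
  "z - w = Gauss_Int (ReZ z - ReZ w) (ImZ z - ImZ w)"
definition times_gauss_int :: "gauss_int \<Rightarrow> gauss_int \<Rightarrow> gauss_int" where
  "z * w = Gauss_Int (ReZ z * ReZ w - ImZ z * ImZ w) (ReZ z * ImZ w + ImZ z * ReZ w)"

instance
  by standard
    (simp_all add: gauss_int_eq_iff zero_gauss_int_def one_gauss_int_def plus_gauss_int_def
      uminus_gauss_int_def minus_gauss_int_def times_gauss_int_def algebra_simps)

end

definition gauss_i :: gauss_int where
  "gauss_i = Gauss_Int 0 1"


section \<open>The dense Gaussian network\<close>

definition gauss_alpha :: "nat \<Rightarrow> gauss_int" where
  "gauss_alpha k = Gauss_Int (int k) (int k + 1)"

definition network_nodes :: "nat \<Rightarrow> gauss_int set" where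
  "network_nodes k = {z. \<bar>ReZ z\<bar> + \<bar>ImZ z\<bar> \<le> int k}"

definition gauss_mod :: "nat \<Rightarrow> gauss_int \<Rightarrow> gauss_int" where
  "gauss_mod k z = (THE r. r \<in> network_nodes k \<and> gauss_alpha k dvd z - r)"

text \<open>Undirected edges are unordered pairs, written as sets \<^term>\<open>{u, v}\<close>. All graphs below have
  the node set \<^term>\<open>network_nodes k\<close> and are given by their edge sets.\<close>

definition network_edges :: "nat \<Rightarrow> gauss_int set set" where
  "network_edges k = {{A, B} | A B. A \<in> network_nodes k \<and> B \<in> network_nodes k \<and>
     (\<exists>u\<in>{1, -1, gauss_i, - gauss_i}. gauss_alpha k dvd (A - B) - u)}"

definition is_path :: "'a set set \<Rightarrow> 'a \<Rightarrow> 'a \<Rightarrow> 'a list \<Rightarrow> bool" where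
  "is_path E a b p \<longleftrightarrow> p \<noteq> [] \<and> hd p = a \<and> last p = b \<and> distinct p \<and>
     successively (\<lambda>u v. {u, v} \<in> E) p"


section \<open>The four trees\<close>

definition vertical_edges :: "nat \<Rightarrow> gauss_int set set" where
  "vertical_edges k = {{v, gauss_mod k (v + gauss_i)} | v. v \<in> network_nodes k}"

definition first_tree_edges :: "nat \<Rightarrow> gauss_int set set" where
  "first_tree_edges k =
     (vertical_edges k -
        ({{Gauss_Int 0 q, Gauss_Int 0 (q + 1)} | q. 0 \<le> q \<and> q \<le> int k - 1} \<union>
         {{Gauss_Int q (- 1), Gauss_Int q 0} | q. - int k + 1 \<le> q \<and> q \<le> 0} \<union>
         {{Gauss_Int (- int k) 0, Gauss_Int 0 (int k)}})) \<union>
     {{Gauss_Int q 0, Gauss_Int (q + 1) 0} | q. 0 \<le> q \<and> q \<le> int k - 1} \<union>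
     {{Gauss_Int (- 1) q, Gauss_Int 0 q} | q. 1 \<le> q \<and> q \<le> int k - 1} \<union>
     {{Gauss_Int (int k) 0, Gauss_Int 0 (int k)}}"

definition gauss_rot :: "gauss_int \<Rightarrow> gauss_int" where
  "gauss_rot z = Gauss_Int (- ImZ z) (ReZ z)"

definition tree_edges :: "nat \<Rightarrow> nat \<Rightarrow> gauss_int set set" where
  "tree_edges k j = (\<lambda>e. (gauss_rot ^^ (j - 1)) ` e) ` first_tree_edges k"

definition rooted_tree_edges :: "nat \<Rightarrow> gauss_int \<Rightarrow> nat \<Rightarrow> gauss_int set set" where
  "rooted_tree_edges k S j = (\<lambda>e. (\<lambda>x. gauss_mod k (x + S)) ` e) ` tree_edges k j"

text \<open>The node \<open>u\<close> immediately precedes \<open>v\<close> on a path that starts at the root \<open>r\<close>.\<close>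

definition is_parent :: "'a set set \<Rightarrow> 'a \<Rightarrow> 'a \<Rightarrow> 'a \<Rightarrow> bool" where
  "is_parent E r u v \<longleftrightarrow> (\<exists>p. is_path E r v (p @ [u, v]))"


section \<open>The parallel construction procedure\<close>

text \<open>What a node \<open>v\<close> determines from a packet with content \<open>a\<close> (the address of the root): it
  computes its relative address, looks up its parent and children in the \<open>j\<close>-th tree rooted at
  \<open>0\<close>, and translates these back by \<open>a\<close>.\<close>

definition relative_address :: "nat \<Rightarrow> gauss_int \<Rightarrow> gauss_int \<Rightarrow> gauss_int" where
  "relative_address k a v = gauss_mod k (v - a)"

definition determined_parent :: "nat \<Rightarrow> gauss_int \<Rightarrow> gauss_int \<Rightarrow> nat \<Rightarrow> gauss_int" where
  "determined_parent k a v j =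
     gauss_mod k ((THE u. is_parent (tree_edges k j) 0 u (relative_address k a v)) + a)"

definition determined_children :: "nat \<Rightarrow> gauss_int \<Rightarrow> gauss_int \<Rightarrow> nat \<Rightarrow> gauss_int set" where
  "determined_children k a v j =
     (\<lambda>c. gauss_mod k (c + a)) ` {c. is_parent (tree_edges k j) 0 (relative_address k a v) c}"

text \<open>A message \<open>(u, v, a)\<close> is a packet with content \<open>a\<close> sent by \<open>u\<close> along the edge to \<open>v\<close>. The
  memory of a node is \<^term>\<open>None\<close> until it first receives a packet; then it is
  \<^term>\<open>Some (u, a)\<close> for the sender \<open>u\<close> and content \<open>a\<close> of the copy treated as the first.
  The root and the faulty nodes never record anything.\<close>

type_synonym message = "gauss_int \<times> gauss_int \<times> gauss_int"
type_synonym memory = "gauss_int \<Rightarrow> (gauss_int \<times> gauss_int) option"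

definition initial_messages :: "nat \<Rightarrow> gauss_int \<Rightarrow> message set" where
  "initial_messages k S = {(S, w, S) | w. {S, w} \<in> network_edges k}"

definition reception ::
    "nat \<Rightarrow> gauss_int \<Rightarrow> gauss_int set \<Rightarrow> message set \<Rightarrow> memory \<Rightarrow> memory \<Rightarrow> bool" where
  "reception k S F msgs old new \<longleftrightarrow>
     (\<forall>v. if v \<in> network_nodes k - F - {S} \<and> old v = None \<and> (\<exists>u a. (u, v, a) \<in> msgs)
          then \<exists>u a. (u, v, a) \<in> msgs \<and> new v = Some (u, a)
          else new v = old v)"

definition forwarded_messages :: "nat \<Rightarrow> memory \<Rightarrow> memory \<Rightarrow> message set" where
  "forwarded_messages k old new =
     {(v, w, a) | v w a. \<exists>u. old v = None \<and> new v = Some (u, a) \<and>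
        {v, w} \<in> network_edges k \<and> w \<noteq> u}"

text \<open>\<open>M t\<close> is the set of messages sent (and received) in step \<open>t\<close>, where steps are numbered from
  \<open>1\<close>, and \<open>R t\<close> is the memory of all nodes after step \<open>t\<close>. The choice among copies
  arriving in the same step makes the procedure nondeterministic.\<close>

definition is_execution ::
    "nat \<Rightarrow> gauss_int \<Rightarrow> gauss_int set \<Rightarrow> (nat \<Rightarrow> message set) \<Rightarrow> (nat \<Rightarrow> memory) \<Rightarrow> bool" where
  "is_execution k S F M R \<longleftrightarrow>
     M 0 = {} \<and> R 0 = (\<lambda>_. None) \<and> M 1 = initial_messages k S \<and>
     (\<forall>t. reception k S F (M (t + 1)) (R t) (R (t + 1)) \<and>
          M (t + 2) = forwarded_messages k (R t) (R (t + 1)))"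

definition terminates_after :: "(nat \<Rightarrow> message set) \<Rightarrow> nat \<Rightarrow> bool" where
  "terminates_after M T \<longleftrightarrow> M T \<noteq> {} \<and> (\<forall>t>T. M t = {})"

lemma reception_exists: "\<exists>new. reception k S F msgs old new"
proof -
  let ?C = "\<lambda>v. v \<in> network_nodes k - F - {S} \<and> old v = None \<and> (\<exists>u a. (u, v, a) \<in> msgs)"
  let ?new = "\<lambda>v. if ?C v then Some (SOME (u, a). (u, v, a) \<in> msgs) else old v"
  have "\<exists>u a. (u, v, a) \<in> msgs \<and> ?new v = Some (u, a)" if C: "?C v" for v
  proof -
    obtain u a where ua: "(SOME (u, a). (u, v, a) \<in> msgs) = (u, a)" by fastforce
    have "\<exists>x. case x of (u, a) \<Rightarrow> (u, v, a) \<in> msgs" using C by auto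
    from someI_ex[OF this] have "(u, v, a) \<in> msgs" unfolding ua by simp
    then show ?thesis unfolding if_P[OF C] ua by blast
  qed
  then have "reception k S F msgs old ?new"
    unfolding reception_def by (intro allI) (smt (verit, best))
  then show ?thesis by blast
qed

lemma execution_exists: "\<exists>M R. is_execution k S F M R"
proof -
  define pick where "pick msgs old = (SOME new. reception k S F msgs old new)" for msgs old
  have pick: "reception k S F msgs old (pick msgs old)" for msgs old
    unfolding pick_def using someI_ex[OF reception_exists] .
  define nxt where
    "nxt x = (forwarded_messages k (snd x) (pick (fst x) (snd x)), pick (fst x) (snd x))" for x
  define c where "c t = (nxt ^^ t) (initial_messages k S, \<lambda>_. None)" for t
  have c: "c 0 = (initial_messages k S, \<lambda>_. None)" "c (Suc t) = nxt (c t)" for t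
    by (simp_all add: c_def)
  define M where "M t = (case t of 0 \<Rightarrow> {} | Suc n \<Rightarrow> fst (c n))" for t
  have "is_execution k S F M (\<lambda>t. snd (c t))"
    unfolding is_execution_def by (simp add: M_def c nxt_def pick)
  then show ?thesis by blast
qed

end

(* Every edge of the first tree joins a node v to an explicitly given parent, and the path from the
   root to v has length at most 2 k and consists of at most three axis-parallel segments, with one
   extra node when v lies on the positive imaginary axis. Comparing these segments with their
   rotations shows that the four paths from the root to v meet only in their end points, so three
   faults cannot hit all of them. A packet travels along a fault-free path at least as fast as one
   edge per step: a node omits a neighbor when forwarding only if that neighbor already has the
   packet. Without faults, the time of arrival is the l1 norm of the relative address, as
   reduction modulo alpha never increases this norm. *)

theory Submission
  imports Defs
begin

section \<open>Reduction modulo \<open>gauss_alpha k\<close>\<close>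

text \<open>The bound 2 k is the height of each tree. In the first tree a path to a node with
  \<open>ReZ\<close> at most 0, other than the root, takes k edges to a boundary node of norm k and
  one wraparound edge; at most k - 1 edges remain. The deepest nodes are i, -1 and -i, although they
  are neighbors of the root. Since the trees are given as undirected edge sets and parents are
  defined through paths, the edge set is first matched, in both inclusions, with a parent map; a
  path from the root can then only descend, which makes parents unique. Disjointness is not proved
  on lists of nodes: the paths are enclosed in sets cut out by linear inequalities. Only the
  relative rotation of two trees matters, so three comparisons settle all six pairs. That the
  fault-free run lasts exactly k + 1 steps also needs a lower bound on arrival times: the norm of
  the relative address grows by at most 1 per hop, also across the boundary.\<close>

lemma gauss_int_simps [simp]:
  "ReZ 0 = 0" "ImZ 0 = 0" "ReZ 1 = 1" "ImZ 1 = 0" "ReZ gauss_i = 0" "ImZ gauss_i = 1"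
  "ReZ (z + w) = ReZ z + ReZ w" "ImZ (z + w) = ImZ z + ImZ w"
  "ReZ (z - w) = ReZ z - ReZ w" "ImZ (z - w) = ImZ z - ImZ w"
  "ReZ (- z) = - ReZ z" "ImZ (- z) = - ImZ z"
  "ReZ (z * w) = ReZ z * ReZ w - ImZ z * ImZ w" "ImZ (z * w) = ReZ z * ImZ w + ImZ z * ReZ w"
  by (simp_all add: zero_gauss_int_def one_gauss_int_def gauss_i_def plus_gauss_int_def
      minus_gauss_int_def uminus_gauss_int_def times_gauss_int_def)

definition l1_norm :: "gauss_int \<Rightarrow> int" where
  "l1_norm z = \<bar>ReZ z\<bar> + \<bar>ImZ z\<bar>"

lemma network_nodes_iff: "z \<in> network_nodes k \<longleftrightarrow> l1_norm z \<le> int k"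
  by (simp add: network_nodes_def l1_norm_def)

lemma zero_in_network [simp]: "0 \<in> network_nodes k"
  by (simp add: network_nodes_iff l1_norm_def)

lemma gauss_alpha_dvdI:
  assumes "ReZ z = a * int k - b * (int k + 1)" "ImZ z = a * (int k + 1) + b * int k"
  shows "gauss_alpha k dvd z"
proof (rule dvdI)
  show "z = gauss_alpha k * Gauss_Int a b"
    using assms by (simp add: gauss_int_eq_iff gauss_alpha_def algebra_simps)
qed

lemma gauss_alpha_dvdE:
  assumes "gauss_alpha k dvd z"
  obtains a b where "ReZ z = a * int k - b * (int k + 1)" "ImZ z = a * (int k + 1) + b * int k"
proof -
  obtain c where "z = gauss_alpha k * c" using assms by (elim dvdE)
  then show thesis by (intro that[of "ReZ c" "ImZ c"]) (simp_all add: gauss_alpha_def algebra_simps)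
qed

text \<open>In the coordinates \<open>x + y\<close> and \<open>y - x\<close>, the multiple of \<open>gauss_alpha k\<close> by \<open>a + b i\<close> is
  \<open>(a n - b, a + b n)\<close> with \<open>n = 2 k + 1\<close>.\<close>

lemma small_lattice_point_nonpos:
  fixes a b n :: int
  assumes "n \<ge> 1" "\<bar>a * n - b\<bar> < n" "\<bar>a + b * n\<bar> < n"
  shows "a \<le> 0"
proof (rule ccontr)
  assume "\<not> a \<le> 0"
  then have "1 * n \<le> a * n" using assms(1) by (intro mult_right_mono) auto
  then have "b \<ge> 1" using assms(2) by linarith
  then have "1 * n \<le> b * n" using assms(1) by (intro mult_right_mono) auto
  then show False using assms(3) \<open>\<not> a \<le> 0\<close> by linarith
qed

text \<open>The sign lemma applied to (a, b) and to (-a, -b) leaves a = 0, and then |b n| < n leaves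
  b = 0. The bound 2 k is what the difference of two nodes can reach; it is sharp, as
  \<open>gauss_alpha k\<close> itself has norm 2 k + 1.\<close>

lemma gauss_alpha_dvd_small:
  assumes "gauss_alpha k dvd z" "l1_norm z \<le> 2 * int k"
  shows "z = 0"
proof -
  obtain a b where ab: "ReZ z = a * int k - b * (int k + 1)" "ImZ z = a * (int k + 1) + b * int k"
    using assms(1) by (rule gauss_alpha_dvdE)
  let ?n = "2 * int k + 1"
  have "a * ?n - b = ReZ z + ImZ z" "a + b * ?n = ImZ z - ReZ z"
    using ab by (simp_all add: algebra_simps)
  then have small: "\<bar>a * ?n - b\<bar> < ?n" "\<bar>a + b * ?n\<bar> < ?n"
    using assms(2) unfolding l1_norm_def by linarith+
  have "a \<le> 0" using small by (intro small_lattice_point_nonpos[of ?n a b]) auto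
  moreover have "- a \<le> 0" using small by (intro small_lattice_point_nonpos[of ?n "- a" "- b"]) auto
  ultimately have "a = 0" by simp
  moreover have "b = 0"
  proof (rule ccontr)
    assume "b \<noteq> 0"
    then have "1 * ?n \<le> \<bar>b\<bar> * ?n" by (intro mult_right_mono) auto
    also have "\<dots> = \<bar>b * ?n\<bar>" by (simp add: abs_mult)
    finally show False using small(2) \<open>a = 0\<close> by simp
  qed
  ultimately show ?thesis using ab by (simp add: gauss_int_eq_iff)
qed

lemma representative_unique:
  assumes "r \<in> network_nodes k" "s \<in> network_nodes k" "gauss_alpha k dvd r - s"
  shows "r = s"
proof -
  have "l1_norm (r - s) \<le> 2 * int k"
    using assms(1,2) by (simp add: network_nodes_iff l1_norm_def)
  then show ?thesis using gauss_alpha_dvd_small assms(3) by fastforce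
qed

text \<open>In the quadrant \<open>x \<ge> 0\<close>, \<open>y > 0\<close>, subtracting \<open>gauss_alpha k\<close> decreases any norm exceeding
  \<open>k\<close>; the other quadrants are rotations of this one.\<close>

lemma norm_descent:
  assumes "z \<notin> network_nodes k"
  shows "\<exists>c. l1_norm (z - gauss_alpha k * c) < l1_norm z"
proof -
  have big: "l1_norm z > int k" using assms by (simp add: network_nodes_iff)
  \<comment> \<open>The quadrants are half-open for a reason: at z = k + 1 subtracting
    \<open>gauss_alpha k\<close> would raise the norm to k + 2, so the positive real axis has to go
    with the fourth quadrant.\<close>
  consider "ReZ z \<ge> 0" "ImZ z > 0" | "ReZ z < 0" "ImZ z \<ge> 0" | "ReZ z \<le> 0" "ImZ z < 0"
    | "ReZ z > 0" "ImZ z \<le> 0"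
    using big unfolding l1_norm_def by linarith
  then show ?thesis
  proof cases
    case 1
    then show ?thesis using big
      by (intro exI[of _ 1]) (simp add: l1_norm_def gauss_alpha_def)
  next
    case 2
    then show ?thesis using big
      by (intro exI[of _ gauss_i]) (simp add: l1_norm_def gauss_alpha_def)
  next
    case 3
    then show ?thesis using big
      by (intro exI[of _ "-1"]) (simp add: l1_norm_def gauss_alpha_def)
  next
    case 4
    then show ?thesis using big
      by (intro exI[of _ "- gauss_i"]) (simp add: l1_norm_def gauss_alpha_def)
  qed
qed

lemma representative_exists: "\<exists>r \<in> network_nodes k. gauss_alpha k dvd z - r"
proof (induction "nat (l1_norm z)" arbitrary: z rule: less_induct)
  case less
  show ?case
  proof (cases "z \<in> network_nodes k")
    case True
    then show ?thesis by (intro bexI[of _ z]) simp_all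
  next
    case False
    then obtain c where "l1_norm (z - gauss_alpha k * c) < l1_norm z" using norm_descent by blast
    moreover have "l1_norm z > 0" using False by (simp add: network_nodes_iff)
    ultimately obtain r where r: "r \<in> network_nodes k" "gauss_alpha k dvd z - gauss_alpha k * c - r"
      using less[of "z - gauss_alpha k * c"] by auto
    have "z - r = (z - gauss_alpha k * c - r) + gauss_alpha k * c" by simp
    then show ?thesis using r by (metis dvd_add dvd_triv_left)
  qed
qed

lemma gauss_mod_eqI:
  assumes "r \<in> network_nodes k" "gauss_alpha k dvd z - r"
  shows "gauss_mod k z = r"
  unfolding gauss_mod_def
proof (rule the_equality)
  fix s assume "s \<in> network_nodes k \<and> gauss_alpha k dvd z - s"
  moreover have "s - r = (z - r) - (z - s)" by simp
  ultimately show "s = r" using assms representative_unique by (metis dvd_diff)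
qed (use assms in simp)

lemma gauss_mod_in [simp]: "gauss_mod k z \<in> network_nodes k"
  and gauss_alpha_dvd_diff_mod: "gauss_alpha k dvd z - gauss_mod k z"
  using representative_exists[of k z] gauss_mod_eqI by auto

lemma gauss_mod_idem: "z \<in> network_nodes k \<Longrightarrow> gauss_mod k z = z"
  by (simp add: gauss_mod_eqI)

lemma gauss_mod_eq_iff: "gauss_mod k z = gauss_mod k w \<longleftrightarrow> gauss_alpha k dvd z - w"
proof
  assume "gauss_mod k z = gauss_mod k w"
  then have "z - w = (z - gauss_mod k z) - (w - gauss_mod k w)" by simp
  then show "gauss_alpha k dvd z - w" by (metis dvd_diff gauss_alpha_dvd_diff_mod)
next
  assume "gauss_alpha k dvd z - w"
  moreover have "z - gauss_mod k w = (z - w) + (w - gauss_mod k w)" by simp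
  ultimately have "gauss_alpha k dvd z - gauss_mod k w"
    by (metis dvd_add gauss_alpha_dvd_diff_mod)
  then show "gauss_mod k z = gauss_mod k w" by (simp add: gauss_mod_eqI)
qed

lemma gauss_mod_mult_add: "gauss_mod k (c * gauss_mod k z + w) = gauss_mod k (c * z + w)"
proof -
  have "c * gauss_mod k z + w - (c * z + w) = - (c * (z - gauss_mod k z))"
    by (simp add: algebra_simps)
  then show ?thesis
    unfolding gauss_mod_eq_iff by (metis dvd_minus_iff dvd_mult gauss_alpha_dvd_diff_mod)
qed

lemma gauss_mod_add: "gauss_mod k (gauss_mod k z + w) = gauss_mod k (z + w)"
  using gauss_mod_mult_add[of k 1] by simp

lemma gauss_mod_diff: "gauss_mod k (gauss_mod k z - w) = gauss_mod k (z - w)"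
  using gauss_mod_add[of k z "- w"] by simp

lemma l1_norm_gauss_mod_le: "l1_norm (gauss_mod k z) \<le> l1_norm z"
proof (cases "z \<in> network_nodes k")
  case False
  then show ?thesis using gauss_mod_in[of k z] unfolding network_nodes_iff by linarith
qed (simp add: gauss_mod_idem)

section \<open>Adjacency and rotations\<close>

definition directions :: "gauss_int set" where
  "directions = {1, -1, gauss_i, - gauss_i}"

text \<open>A doubleton does not remember which end was called \<open>A\<close>; the oriented
  condition can be recovered because \<open>directions\<close> is closed under negation.\<close>

lemma network_edge_iff:
  "{A, B} \<in> network_edges k \<longleftrightarrow> A \<in> network_nodes k \<and> B \<in> network_nodes k \<and>
     (\<exists>u \<in> directions. gauss_alpha k dvd A - B - u)"
proof -
  have sym: "\<exists>u \<in> directions. gauss_alpha k dvd A - B - u"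
    if "u \<in> directions" "gauss_alpha k dvd B - A - u" for A B u
  proof (rule bexI)
    have "A - B - (- u) = - (B - A - u)" by simp
    then show "gauss_alpha k dvd A - B - (- u)" using that by (metis dvd_minus_iff)
    show "- u \<in> directions" using that(1) by (auto simp: directions_def)
  qed
  show ?thesis (is "?lhs \<longleftrightarrow> ?rhs")
  proof
    assume ?lhs
    then show ?rhs
      unfolding network_edges_def directions_def[symmetric] using sym
      by (auto simp: doubleton_eq_iff simp del: insert_iff)
  next
    assume ?rhs
    then show ?lhs unfolding network_edges_def directions_def by blast
  qed
qed

lemma network_edge_step:
  assumes "v \<in> network_nodes k" "d \<in> directions"
  shows "{v, gauss_mod k (v + d)} \<in> network_edges k"
proof -
  have "v - gauss_mod k (v + d) - (- d) = v + d - gauss_mod k (v + d)" by simp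
  then have "gauss_alpha k dvd v - gauss_mod k (v + d) - (- d)"
    by (metis gauss_alpha_dvd_diff_mod)
  moreover have "- d \<in> directions" using assms(2) by (auto simp: directions_def)
  ultimately show ?thesis
    unfolding network_edge_iff using assms(1) gauss_mod_in by (intro conjI bexI[of _ "- d"])
qed

lemma gauss_i_power_norm: "l1_norm (gauss_i ^ n * z) = l1_norm z"
proof (induction n)
  case (Suc n)
  have "l1_norm (gauss_i * (gauss_i ^ n * z)) = l1_norm (gauss_i ^ n * z)"
    unfolding l1_norm_def by simp
  then show ?case using Suc by (simp add: mult.assoc)
qed simp

lemma minus_gauss_i_power_norm: "l1_norm ((- gauss_i) ^ n * z) = l1_norm z"
proof -
  have "l1_norm (- w) = l1_norm w" for w by (simp add: l1_norm_def)
  then show ?thesis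
    by (cases "even n") (simp_all add: gauss_i_power_norm power_minus_odd)
qed

lemma gauss_i_power_cancel [simp]:
  "(- gauss_i) ^ n * (gauss_i ^ n * z) = z" "gauss_i ^ n * ((- gauss_i) ^ n * z) = z"
proof -
  have "(- gauss_i) * gauss_i = 1" by (simp add: gauss_int_eq_iff)
  then have "(- gauss_i) ^ n * gauss_i ^ n = 1" by (metis power_mult_distrib power_one)
  then show "(- gauss_i) ^ n * (gauss_i ^ n * z) = z" "gauss_i ^ n * ((- gauss_i) ^ n * z) = z"
    by (metis mult.assoc mult.commute mult_1)+
qed

lemma gauss_i_power_directions: "u \<in> directions \<Longrightarrow> gauss_i ^ n * u \<in> directions"
proof (induction n)
  case (Suc n)
  then have "gauss_i * (gauss_i ^ n * u) \<in> directions"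
    by (auto simp: directions_def gauss_int_eq_iff)
  then show ?case by (simp add: mult.assoc)
qed simp

lemma gauss_rot_power: "(gauss_rot ^^ n) z = gauss_i ^ n * z"
proof (induction n)
  case (Suc n)
  have "gauss_rot w = gauss_i * w" for w by (simp add: gauss_rot_def gauss_int_eq_iff)
  then show ?case using Suc by (simp add: mult.assoc)
qed simp

section \<open>Transfer between the first tree and the rooted trees\<close>

definition rotate_translate :: "nat \<Rightarrow> gauss_int \<Rightarrow> nat \<Rightarrow> gauss_int \<Rightarrow> gauss_int" where
  "rotate_translate k S n z = gauss_mod k (gauss_i ^ n * z + S)"

text \<open>The inverse of \<open>rotate_translate\<close> on nodes. Reducing before rotating keeps
  the result a node, because rotation preserves the norm. For the j-th tree, n is j - 1.\<close>

definition translate_rotate_back :: "nat \<Rightarrow> gauss_int \<Rightarrow> nat \<Rightarrow> gauss_int \<Rightarrow> gauss_int" where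
  "translate_rotate_back k S n z = (- gauss_i) ^ n * gauss_mod k (z - S)"

lemma rotate_translate_in [simp]: "rotate_translate k S n z \<in> network_nodes k"
  by (simp add: rotate_translate_def)

lemma translate_rotate_back_in [simp]: "translate_rotate_back k S n z \<in> network_nodes k"
  using gauss_mod_in[of k "z - S"]
  by (simp add: translate_rotate_back_def network_nodes_iff minus_gauss_i_power_norm)

lemma rotate_translate_back:
  "v \<in> network_nodes k \<Longrightarrow> rotate_translate k S n (translate_rotate_back k S n v) = v"
  by (simp add: rotate_translate_def translate_rotate_back_def gauss_mod_add gauss_mod_idem)

lemma translate_rotate_back_rotate:
  assumes "z \<in> network_nodes k"
  shows "translate_rotate_back k S n (rotate_translate k S n z) = z"
proof -
  have "gauss_i ^ n * z \<in> network_nodes k"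
    using assms by (simp add: network_nodes_iff gauss_i_power_norm)
  then show ?thesis
    by (simp add: rotate_translate_def translate_rotate_back_def gauss_mod_diff gauss_mod_idem)
qed

lemma inj_on_rotate_translate: "inj_on (rotate_translate k S n) (network_nodes k)"
  by (rule inj_on_inverseI) (rule translate_rotate_back_rotate)

lemma rotate_translate_0 [simp]: "S \<in> network_nodes k \<Longrightarrow> rotate_translate k S n 0 = S"
  by (simp add: rotate_translate_def gauss_mod_idem)

lemma rotate_translate_edge:
  assumes "{A, B} \<in> network_edges k"
  shows "{rotate_translate k S n A, rotate_translate k S n B} \<in> network_edges k"
proof -
  obtain u where u: "u \<in> directions" "gauss_alpha k dvd A - B - u"
    using assms unfolding network_edge_iff by blast
  let ?f = "rotate_translate k S n" and ?g = "\<lambda>z. gauss_i ^ n * z + S"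
  have "?f A - ?f B - gauss_i ^ n * u =
      gauss_i ^ n * (A - B - u) - (?g A - gauss_mod k (?g A)) + (?g B - gauss_mod k (?g B))"
    by (simp add: rotate_translate_def algebra_simps)
  also have "gauss_alpha k dvd \<dots>"
    using dvd_add[OF dvd_diff[OF dvd_mult[OF u(2)] gauss_alpha_dvd_diff_mod]
        gauss_alpha_dvd_diff_mod] .
  finally show ?thesis
    unfolding network_edge_iff using gauss_i_power_directions[OF u(1)] by auto
qed

section \<open>Trees given by a parent map\<close>

lemma is_path_map:
  assumes "is_path E a b p" "inj_on f (set p)"
  shows "is_path ((\<lambda>e. f ` e) ` E) (f a) (f b) (map f p)"
proof -
  have "successively (\<lambda>u v. {f u, f v} \<in> (\<lambda>e. f ` e) ` E) p"
    using assms(1) unfolding is_path_def by (auto elim!: successively_mono intro: rev_image_eqI)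
  then show ?thesis
    using assms unfolding is_path_def
    by (auto simp: successively_map hd_map last_map distinct_map)
qed

text \<open>A path from \<open>r\<close> can only descend. Each edge joins a node to its parent;
  traversed from child to parent, it would lead back to the node visited just before, which
  distinctness forbids. The first edge descends because \<open>r\<close> has no parent edge.\<close>

lemma path_last_edge:
  assumes E: "E = {{v, par v} | v. v \<in> V - {r}}"
    and "is_path E r v (p @ [u, v])"
  shows "v \<in> V - {r} \<and> u = par v"
  using assms(2)
proof (induction p arbitrary: u v rule: rev_induct)
  case Nil
  then have "u = r" "v \<noteq> r" "{u, v} \<in> E" by (auto simp: is_path_def)
  then show ?case unfolding E by (auto simp: doubleton_eq_iff)
next
  case (snoc t p)
  have "{u, v} \<in> E" "v \<noteq> t" "is_path E r u (p @ [t, u])"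
    using snoc.prems by (auto simp: is_path_def successively_append_iff hd_append split: if_splits)
  with snoc.IH have "t = par u" by blast
  obtain w where "w \<in> V - {r}" "{u, v} = {w, par w}" using \<open>{u, v} \<in> E\<close> unfolding E by auto
  then show ?case using \<open>t = par u\<close> \<open>v \<noteq> t\<close> by (auto simp: doubleton_eq_iff)
qed

text \<open>Replaces the path-based notion by an equation, so that the \<open>THE\<close> in
  \<open>determined_parent\<close> can be evaluated. The assumption \<open>paths\<close> gives
  existence; uniqueness comes from the last edge of a path.\<close>

lemma is_parent_iff:
  assumes E: "E = {{v, par v} | v. v \<in> V - {r}}"
    and paths: "\<And>v. v \<in> V \<Longrightarrow> \<exists>p. is_path E r v p"
  shows "is_parent E r u v \<longleftrightarrow> v \<in> V - {r} \<and> u = par v"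
proof
  assume "is_parent E r u v"
  then show "v \<in> V - {r} \<and> u = par v"
    unfolding is_parent_def using path_last_edge[OF E] by blast
next
  assume v: "v \<in> V - {r} \<and> u = par v"
  obtain q where q: "is_path E r v q" using v paths by blast
  then have q': "q = butlast q @ [v]" unfolding is_path_def by (metis append_butlast_last_id)
  have "butlast q \<noteq> []"
    using q v q' unfolding is_path_def by (metis Diff_iff append_Nil insertI1 list.sel(1))
  then obtain p w where "butlast q = p @ [w]" by (metis append_butlast_last_id)
  then have p: "is_path E r v (p @ [w, v])" using q q' by simp
  then have "w = par v" using path_last_edge[OF E] by blast
  then show "is_parent E r u v" unfolding is_parent_def using p v by blast
qed

section \<open>The first tree\<close>

text \<open>From the root, the tree runs along the positive real axis; from there it covers the columns
  \<open>x > 0\<close>. Leaving the top of column \<open>q\<close> it enters column \<open>q - k\<close> from below, and leaving its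
  bottom it enters column \<open>q - k - 1\<close> from above.\<close>

definition tree_parent :: "nat \<Rightarrow> gauss_int \<Rightarrow> gauss_int" where
  "tree_parent k z = (let x = ReZ z; y = ImZ z; K = int k in
     if x > 0 then
       (if y = 0 then Gauss_Int (x - 1) 0 else if y > 0 then Gauss_Int x (y - 1)
        else Gauss_Int x (y + 1))
     else if y < 0 then
       (if y = - (K + x) then Gauss_Int (K + x) (- x) else Gauss_Int x (y - 1))
     else if x < 0 then
       (if y = K + x then Gauss_Int (K + x + 1) (x + 1) else Gauss_Int x (y + 1))
     else if y = K then Gauss_Int K 0 else Gauss_Int (- 1) y)"

text \<open>The number of edges from the root. In the cases with 2 * K + 1 the first K edges lead to
  a boundary node, one edge wraps around, and the remaining term counts the way along the new
  column, plus the final horizontal edge on the positive imaginary axis.\<close>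

definition tree_depth :: "nat \<Rightarrow> gauss_int \<Rightarrow> int" where
  "tree_depth k z = (let x = ReZ z; y = ImZ z; K = int k in
     if x > 0 then x + \<bar>y\<bar>
     else if y < 0 then 2 * K + 1 + x + y
     else if x < 0 then 2 * K + 1 + x - y
     else if y = 0 then 0 else if y = K then K + 1 else 2 * K + 1 - y)"

text \<open>A closed form of the nodes on the path from the root to \<open>z\<close>, linear in all
  coordinates so that linear arithmetic can compare it with its rotations. What gets proved is that
  path nodes satisfy it, which is the direction that disjointness needs.\<close>

definition on_tree_path :: "nat \<Rightarrow> gauss_int \<Rightarrow> gauss_int \<Rightarrow> bool" where
  "on_tree_path k z w \<longleftrightarrow> (let x = ReZ z; y = ImZ z; a = ReZ w; b = ImZ w; K = int k in
     if x > 0 then b = 0 \<and> 0 \<le> a \<and> a \<le> x \<or> a = x \<and> (0 \<le> b \<and> b \<le> y \<or> y \<le> b \<and> b \<le> 0)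
     else if y < 0 then
       b = 0 \<and> 0 \<le> a \<and> a \<le> K + x \<or> a = K + x \<and> 0 \<le> b \<and> b \<le> - x \<or> a = x \<and> - (K + x) \<le> b \<and> b \<le> y
     else if x < 0 then
       b = 0 \<and> 0 \<le> a \<and> a \<le> K + x + 1 \<or> a = K + x + 1 \<and> x + 1 \<le> b \<and> b \<le> 0 \<or>
       a = x \<and> y \<le> b \<and> b \<le> K + x
     else if y = 0 then a = 0 \<and> b = 0
     else if y = K then b = 0 \<and> 0 \<le> a \<and> a \<le> K \<or> a = 0 \<and> b = K
     else b = 0 \<and> 0 \<le> a \<and> a \<le> K \<or> a = - 1 \<and> y \<le> b \<and> b \<le> K - 1 \<or> a = 0 \<and> b = y)"

lemma tree_parent_in:
  "v \<in> network_nodes k \<Longrightarrow> v \<noteq> 0 \<Longrightarrow> tree_parent k v \<in> network_nodes k"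
  by (auto simp: network_nodes_def tree_parent_def Let_def gauss_int_eq_iff)

lemma tree_depth_parent:
  assumes "v \<in> network_nodes k" "v \<noteq> 0"
  shows "tree_depth k (tree_parent k v) = tree_depth k v - 1"
  using assms
  by (cases "ReZ v > 0"; cases "ImZ v < 0"; cases "ReZ v < 0"; cases "ImZ v = 0")
    (auto simp: network_nodes_def tree_parent_def tree_depth_def Let_def gauss_int_eq_iff)

lemma tree_depth_bounds:
  "v \<in> network_nodes k \<Longrightarrow> 0 \<le> tree_depth k v \<and> tree_depth k v \<le> 2 * int k"
  by (auto simp: network_nodes_def tree_depth_def Let_def)

lemma tree_depth_pos:
  "v \<in> network_nodes k \<Longrightarrow> v \<noteq> 0 \<Longrightarrow> 0 < tree_depth k v"
  using tree_depth_parent tree_depth_bounds tree_parent_in by fastforce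

lemma on_tree_path_self: "v \<in> network_nodes k \<Longrightarrow> on_tree_path k v v"
  by (auto simp: network_nodes_def on_tree_path_def Let_def)

lemma on_tree_path_parent:
  assumes "v \<in> network_nodes k" "v \<noteq> 0" "on_tree_path k (tree_parent k v) w"
  shows "on_tree_path k v w"
  using assms
  unfolding network_nodes_def tree_parent_def on_tree_path_def Let_def mem_Collect_eq
    gauss_int_eq_iff gauss_int_simps
  by (smt (z3) gauss_int.sel)

text \<open>Multiplication by \<open>(- gauss_i) ^ d\<close> turns the tree number d + 1 back into
  the first, so the last assumption says that \<open>w\<close> lies on the path to \<open>v\<close>
  in that tree. The initial segments lie on different half-axes; the other combinations of segments
  are finitely many linear systems in x, y, a, b and k.\<close>

lemma tree_paths_disjoint:
  assumes "k \<ge> 1" "v \<in> network_nodes k" "d \<in> {1, 2, 3}"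
    and "on_tree_path k v w" "on_tree_path k ((- gauss_i) ^ d * v) ((- gauss_i) ^ d * w)"
  shows "w = 0 \<or> w = v"
proof -
  obtain x y a b where [simp]: "v = Gauss_Int x y" "w = Gauss_Int a b"
    by (cases v; cases w)
  have rot: "(- gauss_i) ^ 1 * Gauss_Int s t = Gauss_Int t (- s)"
    "(- gauss_i) ^ 2 * Gauss_Int s t = Gauss_Int (- s) (- t)"
    "(- gauss_i) ^ 3 * Gauss_Int s t = Gauss_Int (- t) s" for s t
    by (simp_all add: gauss_int_eq_iff power2_eq_square power3_eq_cube)
  have bounds: "int k \<ge> 1" "\<bar>x\<bar> + \<bar>y\<bar> \<le> int k"
    using assms(1,2) by (simp_all add: network_nodes_def)
  consider "d = 1" | "d = 2" | "d = 3" using assms(3) by blast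
  then have "a = 0 \<and> b = 0 \<or> a = x \<and> b = y"
  proof cases
    case 1
    then show ?thesis
      using bounds assms(4,5)
      unfolding \<open>v = _\<close> \<open>w = _\<close> \<open>d = 1\<close> rot on_tree_path_def Let_def gauss_int.sel
      by (smt (z3))
  next
    case 2
    then show ?thesis
      using bounds assms(4,5)
      unfolding \<open>v = _\<close> \<open>w = _\<close> \<open>d = 2\<close> rot on_tree_path_def Let_def gauss_int.sel
      by (smt (z3))
  next
    case 3
    then show ?thesis
      using bounds assms(4,5)
      unfolding \<open>v = _\<close> \<open>w = _\<close> \<open>d = 3\<close> rot on_tree_path_def Let_def gauss_int.sel
      by (smt (z3))
  qed
  then show ?thesis by (simp add: gauss_int_eq_iff)
qed

section \<open>The edges of the first tree are exactly the parent edges\<close>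

lemma vertical_step:
  assumes "v \<in> network_nodes k"
  shows "gauss_mod k (v + gauss_i) =
    (if \<bar>ReZ v\<bar> + \<bar>ImZ v + 1\<bar> \<le> int k then Gauss_Int (ReZ v) (ImZ v + 1)
     else if ReZ v \<ge> 0 then Gauss_Int (ReZ v - int k) (- ReZ v)
     else Gauss_Int (ReZ v + int k + 1) (ReZ v + 1))" (is "_ = ?r")
proof (rule gauss_mod_eqI)
  show "?r \<in> network_nodes k" using assms by (auto simp: network_nodes_def)
  consider "\<bar>ReZ v\<bar> + \<bar>ImZ v + 1\<bar> \<le> int k"
    | "ReZ v \<ge> 0" "ImZ v = int k - ReZ v" "\<not> \<bar>ReZ v\<bar> + \<bar>ImZ v + 1\<bar> \<le> int k"
    | "ReZ v < 0" "ImZ v = int k + ReZ v" "\<not> \<bar>ReZ v\<bar> + \<bar>ImZ v + 1\<bar> \<le> int k"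
    using assms unfolding network_nodes_def by fastforce
  then show "gauss_alpha k dvd v + gauss_i - ?r"
  proof cases
    case 1
    then have "v + gauss_i = ?r" by (simp add: gauss_int_eq_iff)
    then show ?thesis by simp
  next
    case 2
    \<comment> \<open>The wraparound subtracts \<open>gauss_alpha k\<close> for columns with
      \<open>ReZ v\<close> at least 0, and i times it, which is -(k + 1) + k i, for the others;
      hence the coefficients 1, 0 here and 0, 1 below.\<close>
    then show ?thesis by (intro gauss_alpha_dvdI[of _ 1 _ 0]) auto
  next
    case 3
    then show ?thesis by (intro gauss_alpha_dvdI[of _ 0 _ 1]) auto
  qed
qed

text \<open>The excluded \<open>v\<close> are the lower ends of the removed edges. The removed edge
  between -k and k i is the vertical one leaving the top of column 0, as k i + i is congruent to -k;
  this is why the first exclusion reaches up to k i.\<close>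

lemma vertical_edge_in_first_tree:
  assumes "k \<ge> 1" "v \<in> network_nodes k"
    and "\<not> (ReZ v = 0 \<and> 0 \<le> ImZ v)" "\<not> (ReZ v \<le> 0 \<and> ImZ v = - 1)"
  shows "{v, gauss_mod k (v + gauss_i)} \<in> first_tree_edges k"
proof -
  have "{v, gauss_mod k (v + gauss_i)} \<notin>
      {{Gauss_Int 0 q, Gauss_Int 0 (q + 1)} | q. 0 \<le> q \<and> q \<le> int k - 1}"
    using assms(3) by (auto simp: doubleton_eq_iff)
  moreover have "{v, gauss_mod k (v + gauss_i)} \<notin>
      {{Gauss_Int q (- 1), Gauss_Int q 0} | q. - int k + 1 \<le> q \<and> q \<le> 0}"
    using assms unfolding vertical_step[OF assms(2)] by (auto simp: doubleton_eq_iff)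
  moreover have "{v, gauss_mod k (v + gauss_i)} \<noteq> {Gauss_Int (- int k) 0, Gauss_Int 0 (int k)}"
    using assms unfolding vertical_step[OF assms(2)] by (auto simp: doubleton_eq_iff)
  moreover have "{v, gauss_mod k (v + gauss_i)} \<in> vertical_edges k"
    using assms(2) unfolding vertical_edges_def by blast
  ultimately show ?thesis
    unfolding first_tree_edges_def by (intro UnI1 DiffI) simp_all
qed

lemma first_tree_edges_subset:
  assumes "e \<in> first_tree_edges k" "k \<ge> 1"
  shows "\<exists>v \<in> network_nodes k - {0}. e = {v, tree_parent k v}"
proof -
  consider (vertical) v where "v \<in> network_nodes k" "e = {v, gauss_mod k (v + gauss_i)}"
      "e \<notin> {{Gauss_Int 0 q, Gauss_Int 0 (q + 1)} | q. 0 \<le> q \<and> q \<le> int k - 1}"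
      "e \<notin> {{Gauss_Int q (- 1), Gauss_Int q 0} | q. - int k + 1 \<le> q \<and> q \<le> 0}"
      "e \<noteq> {Gauss_Int (- int k) 0, Gauss_Int 0 (int k)}"
    | (axis) q where "0 \<le> q" "q \<le> int k - 1" "e = {Gauss_Int q 0, Gauss_Int (q + 1) 0}"
    | (bridge) q where "1 \<le> q" "q \<le> int k - 1" "e = {Gauss_Int (- 1) q, Gauss_Int 0 q}"
    | (tip) "e = {Gauss_Int (int k) 0, Gauss_Int 0 (int k)}"
    using assms unfolding first_tree_edges_def vertical_edges_def by blast
  then show ?thesis
  proof cases
    case vertical
    obtain x y where v: "v = Gauss_Int x y" by (cases v)
    have xy: "\<bar>x\<bar> + \<bar>y\<bar> \<le> int k" using vertical(1) by (simp add: v network_nodes_def)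
    show ?thesis
    proof (cases "\<bar>x\<bar> + \<bar>y + 1\<bar> \<le> int k")
      case True
      then have e: "e = {Gauss_Int x y, Gauss_Int x (y + 1)}"
        using vertical(1,2) by (simp add: vertical_step v)
      have no_axis: "\<not> (x = 0 \<and> 0 \<le> y)"
      proof
        assume "x = 0 \<and> 0 \<le> y"
        then show False using e True vertical(3) by auto
      qed
      have no_gap: "\<not> (x \<le> 0 \<and> y = - 1)"
      proof
        assume "x \<le> 0 \<and> y = - 1"
        then show False using e xy vertical(4) by auto
      qed
      \<comment> \<open>Paths climb their column in the region of this case split and descend
        elsewhere, so here the child is the upper end and otherwise the lower end.\<close>
      show ?thesis
      proof (cases "y \<ge> 0 \<and> x > 0 \<or> y < 0 \<and> x \<le> 0")
        case upper: True
        have "tree_parent k (Gauss_Int x (y + 1)) = Gauss_Int x y"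
          using upper no_gap xy by (auto simp: tree_parent_def Let_def)
        then show ?thesis using e True upper no_gap
          by (intro bexI[of _ "Gauss_Int x (y + 1)"])
            (auto simp: network_nodes_def gauss_int_eq_iff)
      next
        case False
        then have "tree_parent k (Gauss_Int x y) = Gauss_Int x (y + 1)"
          using no_axis no_gap True by (auto simp: tree_parent_def Let_def)
        then show ?thesis using e xy False no_axis
          by (intro bexI[of _ "Gauss_Int x y"]) (auto simp: network_nodes_def gauss_int_eq_iff)
      qed
    next
      case False
      then have top: "y = int k - \<bar>x\<bar>" using xy by linarith
      \<comment> \<open>For x at least 0 a path leaves through the top and the child lies in the new
        column. For negative x the path comes in through the top, so \<open>v\<close> itself is the
        child.\<close>
      show ?thesis
      proof (cases "x \<ge> 0")
        case True
        then have e: "e = {Gauss_Int x y, Gauss_Int (x - int k) (- x)}"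
          using vertical(1,2) False by (simp add: vertical_step v)
        then have "x \<noteq> 0" using vertical(5) top by (auto simp: insert_commute)
        then have "tree_parent k (Gauss_Int (x - int k) (- x)) = Gauss_Int x y"
          using True top xy by (auto simp: tree_parent_def Let_def)
        then show ?thesis using e xy True \<open>x \<noteq> 0\<close> top
          by (intro bexI[of _ "Gauss_Int (x - int k) (- x)"])
            (auto simp: network_nodes_def gauss_int_eq_iff)
      next
        case neg: False
        then have "e = {Gauss_Int x y, Gauss_Int (x + int k + 1) (x + 1)}"
          using vertical(1,2) False by (simp add: vertical_step v)
        moreover have "tree_parent k (Gauss_Int x y) = Gauss_Int (x + int k + 1) (x + 1)"
          using neg top xy by (auto simp: tree_parent_def Let_def)
        ultimately show ?thesis using xy neg
          by (intro bexI[of _ "Gauss_Int x y"]) (auto simp: network_nodes_def gauss_int_eq_iff)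
      qed
    qed
  next
    case axis
    then show ?thesis
      by (intro bexI[of _ "Gauss_Int (q + 1) 0"])
        (auto simp: tree_parent_def Let_def network_nodes_def gauss_int_eq_iff)
  next
    case bridge
    then show ?thesis
      by (intro bexI[of _ "Gauss_Int 0 q"])
        (auto simp: tree_parent_def Let_def network_nodes_def gauss_int_eq_iff)
  next
    case tip
    then show ?thesis using assms(2)
      by (intro bexI[of _ "Gauss_Int 0 (int k)"])
        (auto simp: tree_parent_def Let_def network_nodes_def gauss_int_eq_iff)
  qed
qed

lemma tree_parent_edge:
  assumes "k \<ge> 1" "v \<in> network_nodes k" "v \<noteq> 0"
  shows "{v, tree_parent k v} \<in> first_tree_edges k"
proof -
  obtain x y where v: "v = Gauss_Int x y" by (cases v)
  have xy: "\<bar>x\<bar> + \<bar>y\<bar> \<le> int k" using assms(2) by (simp add: v network_nodes_def)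
  \<comment> \<open>A vertical parent edge goes down or up, modulo \<open>gauss_alpha k\<close>. The
    criterion for edges that survive the removal is applied to the lower end: the parent for
    \<open>down\<close>, the child for \<open>up\<close>.\<close>
  have down: ?thesis
    if "gauss_mod k (tree_parent k v + gauss_i) = v"
      "\<not> (ReZ (tree_parent k v) = 0 \<and> 0 \<le> ImZ (tree_parent k v))"
      "\<not> (ReZ (tree_parent k v) \<le> 0 \<and> ImZ (tree_parent k v) = - 1)"
    using vertical_edge_in_first_tree[OF assms(1) tree_parent_in[OF assms(2,3)]] that
    by (simp add: insert_commute)
  have up: ?thesis
    if "gauss_mod k (v + gauss_i) = tree_parent k v"
      "\<not> (x = 0 \<and> 0 \<le> y)" "\<not> (x \<le> 0 \<and> y = - 1)"
    using vertical_edge_in_first_tree[OF assms(1,2)] that by (simp add: v)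
  have P: "tree_parent k v \<in> network_nodes k" using tree_parent_in assms(2,3) .
  have "x \<noteq> 0 \<or> y \<noteq> 0" using assms(3) v by (simp add: gauss_int_eq_iff)
  consider (axis) "x > 0" "y = 0" | (q1) "x > 0" "y > 0" | (q4) "x > 0" "y < 0"
    | (bottom) "x \<le> 0" "y < 0" "y = - (int k + x)" | (q3) "x \<le> 0" "y < 0" "y \<noteq> - (int k + x)"
    | (q2) "x < 0" "y \<ge> 0" | (bridge) "x = 0" "y > 0" "y < int k" | (tip) "x = 0" "y = int k"
    using \<open>x \<noteq> 0 \<or> y \<noteq> 0\<close> xy by (smt (z3))
  then show ?thesis
  proof cases
    case axis
    then have "{v, tree_parent k v} = {Gauss_Int (x - 1) 0, Gauss_Int (x - 1 + 1) 0}"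
      by (auto simp: v tree_parent_def Let_def)
    moreover have "0 \<le> x - 1" "x - 1 \<le> int k - 1" using axis xy by auto
    ultimately show ?thesis unfolding first_tree_edges_def by blast
  next
    case q1
    then show ?thesis using xy P
      by (intro down) (simp_all add: vertical_step, auto simp: v tree_parent_def Let_def)
  next
    case q4
    then show ?thesis using xy
      by (intro up) (simp_all add: vertical_step assms(2), auto simp: v tree_parent_def Let_def)
  next
    case bottom
    then show ?thesis using xy P
      by (intro down) (simp_all add: vertical_step, auto simp: v tree_parent_def Let_def)
  next
    case q3
    then show ?thesis using xy P
      by (intro down) (simp_all add: vertical_step, auto simp: v tree_parent_def Let_def)
  next
    case q2
    then show ?thesis using xy
      by (intro up) (simp_all add: vertical_step assms(2), auto simp: v tree_parent_def Let_def)
  next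
    case bridge
    then have "{v, tree_parent k v} = {Gauss_Int (- 1) y, Gauss_Int 0 y}"
      by (auto simp: v tree_parent_def Let_def)
    moreover have "1 \<le> y" "y \<le> int k - 1" using bridge by auto
    ultimately show ?thesis unfolding first_tree_edges_def by blast
  next
    case tip
    then have "{v, tree_parent k v} = {Gauss_Int (int k) 0, Gauss_Int 0 (int k)}"
      using assms(1) by (auto simp: v tree_parent_def Let_def)
    then show ?thesis unfolding first_tree_edges_def by blast
  qed
qed

lemma first_tree_edges_eq:
  assumes "k \<ge> 1"
  shows "first_tree_edges k = {{v, tree_parent k v} | v. v \<in> network_nodes k - {0}}"
  using first_tree_edges_subset[OF _ assms] tree_parent_edge[OF assms] by blast

lemma first_tree_edges_network:
  assumes "k \<ge> 1"
  shows "first_tree_edges k \<subseteq> network_edges k"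
proof
  fix e assume "e \<in> first_tree_edges k"
  then consider (vertical) v where "v \<in> network_nodes k" "e = {v, gauss_mod k (v + gauss_i)}"
    | (axis) q where "0 \<le> q" "q \<le> int k - 1" "e = {Gauss_Int q 0, Gauss_Int (q + 1) 0}"
    | (bridge) q where "1 \<le> q" "q \<le> int k - 1" "e = {Gauss_Int (- 1) q, Gauss_Int 0 q}"
    | (tip) "e = {Gauss_Int (int k) 0, Gauss_Int 0 (int k)}"
    unfolding first_tree_edges_def vertical_edges_def by blast
  then show "e \<in> network_edges k"
  proof cases
    case vertical
    then show ?thesis using network_edge_step by (simp add: directions_def)
  next
    case axis
    have "Gauss_Int q 0 - Gauss_Int (q + 1) 0 - (- 1) = 0" by (simp add: gauss_int_eq_iff)
    then have "\<exists>u \<in> directions. gauss_alpha k dvd Gauss_Int q 0 - Gauss_Int (q + 1) 0 - u"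
      by (intro bexI[of _ "- 1"]) (simp_all only: dvd_0_right, simp add: directions_def)
    then show ?thesis using axis unfolding axis(3) network_edge_iff by (simp add: network_nodes_def)
  next
    case bridge
    have "Gauss_Int (- 1) q - Gauss_Int 0 q - (- 1) = 0" by (simp add: gauss_int_eq_iff)
    then have "\<exists>u \<in> directions. gauss_alpha k dvd Gauss_Int (- 1) q - Gauss_Int 0 q - u"
      by (intro bexI[of _ "- 1"]) (simp_all only: dvd_0_right, simp add: directions_def)
    then show ?thesis using bridge unfolding bridge(3) network_edge_iff
      by (simp add: network_nodes_def)
  next
    \<comment> \<open>The number (k + 1) - k i is -i times \<open>gauss_alpha k\<close>, so one step
      to the right of k wraps around to k i; this explains the coefficients 0 and -1.\<close>
    case tip
    have "\<exists>u \<in> directions. gauss_alpha k dvd Gauss_Int (int k) 0 - Gauss_Int 0 (int k) - u"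
      by (intro bexI[of _ "- 1"] gauss_alpha_dvdI[of _ 0 _ "- 1"]) (simp_all add: directions_def)
    then show ?thesis unfolding tip network_edge_iff by (simp add: network_nodes_def)
  qed
qed

text \<open>The depths are carried through the induction to keep the path simple: all nodes on the
  path to the parent are less deep than \<open>v\<close>, so appending \<open>v\<close> repeats none
  of them.\<close>

lemma first_tree_path:
  assumes "k \<ge> 1" "v \<in> network_nodes k"
  shows "\<exists>p. is_path (first_tree_edges k) 0 v p \<and> int (length p) = tree_depth k v + 1 \<and>
    (\<forall>w \<in> set p. w \<in> network_nodes k \<and> on_tree_path k v w \<and> tree_depth k w \<le> tree_depth k v)"
  using assms(2)
proof (induction "nat (tree_depth k v)" arbitrary: v rule: less_induct)
  case less
  show ?case
  proof (cases "v = 0")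
    case True
    then show ?thesis
      using less.prems on_tree_path_self[of 0 k]
      by (intro exI[of _ "[0]"]) (auto simp: is_path_def tree_depth_def)
  next
    case False
    let ?u = "tree_parent k v"
    have u: "?u \<in> network_nodes k" and depth: "tree_depth k ?u = tree_depth k v - 1"
      and edge: "{?u, v} \<in> first_tree_edges k"
      using less.prems False tree_parent_in tree_depth_parent tree_parent_edge[OF assms(1)]
      by (auto simp: insert_commute)
    have "nat (tree_depth k ?u) < nat (tree_depth k v)"
      using depth tree_depth_pos[OF less.prems False] by simp
    then obtain p where p: "is_path (first_tree_edges k) 0 ?u p"
      "int (length p) = tree_depth k ?u + 1"
      "\<forall>w \<in> set p. w \<in> network_nodes k \<and> on_tree_path k ?u w \<and> tree_depth k w \<le> tree_depth k ?u"
      using less.hyps u by blast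
    have "v \<notin> set p" using p(3) depth by force
    then have "is_path (first_tree_edges k) 0 v (p @ [v])"
      using p(1) edge unfolding is_path_def by (simp add: successively_append_iff)
    moreover have "int (length (p @ [v])) = tree_depth k v + 1" using p(2) depth by simp
    moreover have "\<forall>w \<in> set (p @ [v]). w \<in> network_nodes k \<and> on_tree_path k v w \<and>
        tree_depth k w \<le> tree_depth k v"
      using p(3) depth less.prems False on_tree_path_self on_tree_path_parent by auto
    ultimately show ?thesis by blast
  qed
qed

section \<open>The rooted trees\<close>

lemma rooted_tree_edges_eq:
  "rooted_tree_edges k S j = (\<lambda>e. rotate_translate k S (j - 1) ` e) ` first_tree_edges k"
  unfolding rooted_tree_edges_def tree_edges_def
  by (simp add: image_image rotate_translate_def gauss_rot_power)

lemma first_tree_edge_nodes: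
  assumes "k \<ge> 1" "e \<in> first_tree_edges k"
  shows "e \<subseteq> network_nodes k"
  using assms tree_parent_in unfolding first_tree_edges_eq[OF assms(1)] by auto

text \<open>Makes the trees at 0, which a node consults, an instance of the rooted trees: reduction
  does nothing after a rotation, since rotations preserve the node set.\<close>

lemma tree_edges_eq_rooted:
  assumes "k \<ge> 1"
  shows "tree_edges k j = rooted_tree_edges k 0 j"
proof -
  have "(gauss_rot ^^ (j - 1)) z = rotate_translate k 0 (j - 1) z" if "z \<in> network_nodes k" for z
    using that gauss_mod_idem[of "gauss_i ^ (j - 1) * z" k]
    by (simp add: gauss_rot_power rotate_translate_def network_nodes_iff gauss_i_power_norm)
  then have "(gauss_rot ^^ (j - 1)) ` e = rotate_translate k 0 (j - 1) ` e"
    if "e \<in> first_tree_edges k" for e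
    using first_tree_edge_nodes[OF assms that] by (intro image_cong) auto
  then show ?thesis
    unfolding rooted_tree_edges_eq tree_edges_def by (rule image_cong[OF refl])
qed

definition rooted_parent :: "nat \<Rightarrow> gauss_int \<Rightarrow> nat \<Rightarrow> gauss_int \<Rightarrow> gauss_int" where
  "rooted_parent k S j v =
     rotate_translate k S (j - 1) (tree_parent k (translate_rotate_back k S (j - 1) v))"

lemma rooted_tree_edges_parent:
  assumes "k \<ge> 1" "S \<in> network_nodes k"
  shows "rooted_tree_edges k S j = {{v, rooted_parent k S j v} | v. v \<in> network_nodes k - {S}}"
    (is "?E = ?P")
proof -
  let ?f = "rotate_translate k S (j - 1)" and ?g = "translate_rotate_back k S (j - 1)"
  have f0: "?f z = S \<longleftrightarrow> z = 0" if "z \<in> network_nodes k" for z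
    using inj_on_eq_iff[OF inj_on_rotate_translate that zero_in_network]
      rotate_translate_0[OF assms(2)] by metis
  have "?f ` {z, tree_parent k z} \<in> ?P" if "z \<in> network_nodes k" "z \<noteq> 0" for z
    using that f0[OF that(1)] translate_rotate_back_rotate[OF that(1), of S "j - 1"]
    by (auto simp: rooted_parent_def intro!: exI[of _ "?f z"])
  then have "?E \<subseteq> ?P"
    unfolding rooted_tree_edges_eq first_tree_edges_eq[OF assms(1)] by blast
  moreover have "{v, rooted_parent k S j v} \<in> ?E" if "v \<in> network_nodes k - {S}" for v
  proof -
    have v: "?f (?g v) = v" using that rotate_translate_back by blast
    then have "?g v \<noteq> 0"
      using that f0[OF translate_rotate_back_in, of S "j - 1" v] by auto
    then have "{?g v, tree_parent k (?g v)} \<in> first_tree_edges k"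
      using tree_parent_edge[OF assms(1)] by simp
    then have "?f ` {?g v, tree_parent k (?g v)} \<in> ?E"
      unfolding rooted_tree_edges_eq by blast
    then show ?thesis unfolding image_insert image_empty v rooted_parent_def .
  qed
  ultimately show ?thesis by blast
qed

lemma rooted_tree_edges_network:
  assumes "k \<ge> 1"
  shows "rooted_tree_edges k S j \<subseteq> network_edges k"
proof
  fix e assume "e \<in> rooted_tree_edges k S j"
  then obtain v where "v \<in> network_nodes k - {0}"
    "e = rotate_translate k S (j - 1) ` {v, tree_parent k v}"
    unfolding rooted_tree_edges_eq first_tree_edges_eq[OF assms] by blast
  moreover from this have "{v, tree_parent k v} \<in> network_edges k"
    using tree_parent_edge[OF assms] first_tree_edges_network[OF assms] by blast
  ultimately show "e \<in> network_edges k" using rotate_translate_edge by simp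
qed

lemma rooted_tree_path:
  assumes "k \<ge> 1" "S \<in> network_nodes k" "v \<in> network_nodes k"
  obtains p where "is_path (rooted_tree_edges k S j) S v p" "length p \<le> 2 * k + 1"
    "set p \<subseteq> network_nodes k"
    "\<forall>w \<in> set p.
       on_tree_path k (translate_rotate_back k S (j - 1) v) (translate_rotate_back k S (j - 1) w)"
proof -
  let ?f = "rotate_translate k S (j - 1)" and ?g = "translate_rotate_back k S (j - 1)"
  obtain p where p: "is_path (first_tree_edges k) 0 (?g v) p"
    "int (length p) = tree_depth k (?g v) + 1"
    "\<forall>w \<in> set p. w \<in> network_nodes k \<and> on_tree_path k (?g v) w"
    using first_tree_path[OF assms(1), of "?g v"] by auto
  have "inj_on ?f (set p)"
    using p(3) by (intro inj_on_subset[OF inj_on_rotate_translate]) auto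
  from is_path_map[OF p(1) this] have "is_path (rooted_tree_edges k S j) S v (map ?f p)"
    unfolding rooted_tree_edges_eq using assms rotate_translate_back by simp
  moreover have "length (map ?f p) \<le> 2 * k + 1"
    using p(2) tree_depth_bounds[of "?g v" k] by simp
  moreover have "set (map ?f p) \<subseteq> network_nodes k" by auto
  moreover have "\<forall>w \<in> set (map ?f p). on_tree_path k (?g v) (?g w)"
    using p(3) translate_rotate_back_rotate by auto
  ultimately show thesis by (rule that)
qed

lemma is_parent_rooted_iff:
  assumes "k \<ge> 1" "S \<in> network_nodes k"
  shows "is_parent (rooted_tree_edges k S j) S u v \<longleftrightarrow>
    v \<in> network_nodes k - {S} \<and> u = rooted_parent k S j v"
proof (rule is_parent_iff[OF rooted_tree_edges_parent[OF assms]])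
  fix w assume "w \<in> network_nodes k"
  then obtain p where "is_path (rooted_tree_edges k S j) S w p"
    by (rule rooted_tree_path[OF assms, where j = j])
  then show "\<exists>p. is_path (rooted_tree_edges k S j) S w p" ..
qed

section \<open>Parents and children computed from relative addresses\<close>

lemma relative_address_eq_0_iff:
  assumes "v \<in> network_nodes k" "S \<in> network_nodes k"
  shows "relative_address k S v = 0 \<longleftrightarrow> v = S"
proof
  assume "relative_address k S v = 0"
  then have "gauss_alpha k dvd v - S"
    using gauss_alpha_dvd_diff_mod[of k "v - S"] by (simp add: relative_address_def)
  then show "v = S" using representative_unique assms by blast
qed (simp add: relative_address_def gauss_mod_idem)

text \<open>Translation equivariance of the parent map: the link between what a node computes at the
  origin and the tree rooted at \<open>S\<close>.\<close>

lemma rooted_parent_relative: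
  "rooted_parent k S j v = gauss_mod k (rooted_parent k 0 j (relative_address k S v) + S)"
  unfolding rooted_parent_def rotate_translate_def translate_rotate_back_def relative_address_def
  by (simp add: gauss_mod_add gauss_mod_idem)

lemma determined_parent_correct:
  assumes "k \<ge> 1" "S \<in> network_nodes k" "v \<in> network_nodes k - {S}"
  shows "{w. is_parent (rooted_tree_edges k S j) S w v} = {determined_parent k S v j}"
proof -
  have "relative_address k S v \<in> network_nodes k - {0}"
    using assms relative_address_eq_0_iff by (auto simp: relative_address_def)
  then have "(THE u. is_parent (tree_edges k j) 0 u (relative_address k S v)) =
      rooted_parent k 0 j (relative_address k S v)"
    by (simp add: tree_edges_eq_rooted[OF assms(1)] is_parent_rooted_iff[OF assms(1)])
  then show ?thesis
    using assms rooted_parent_relative[of k S j v]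
    by (auto simp: determined_parent_def is_parent_rooted_iff)
qed

lemma determined_children_correct:
  assumes "k \<ge> 1" "S \<in> network_nodes k" "v \<in> network_nodes k - {S}"
  shows "{c. is_parent (rooted_tree_edges k S j) S v c} = determined_children k S v j"
proof -
  \<comment> \<open>\<open>?t\<close> and \<open>?a\<close> are inverse bijections of the node set
    that exchange 0 and \<open>S\<close> and match the two parent maps; children are therefore
    carried along.\<close>
  let ?t = "\<lambda>c. gauss_mod k (c + S)" and ?a = "relative_address k S"
  have ta: "?t (?a c) = c" if "c \<in> network_nodes k" for c
    using that by (simp add: relative_address_def gauss_mod_add gauss_mod_idem)
  have at: "?a (?t c) = c" if "c \<in> network_nodes k" for c
    using that by (simp add: relative_address_def gauss_mod_diff gauss_mod_idem)
  have parent_in: "rooted_parent k 0 j c \<in> network_nodes k" for c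
    by (simp add: rooted_parent_def)
  have *: "v = rooted_parent k S j c \<longleftrightarrow> ?a v = rooted_parent k 0 j (?a c)" for c
    using ta[of v] at[OF parent_in] assms(3) rooted_parent_relative[of k S j c] by auto
  have "determined_children k S v j =
      ?t ` {c \<in> network_nodes k - {0}. ?a v = rooted_parent k 0 j c}"
    by (simp add: determined_children_def tree_edges_eq_rooted[OF assms(1)]
        is_parent_rooted_iff[OF assms(1)])
  also have "\<dots> = {c \<in> network_nodes k - {S}. v = rooted_parent k S j c}"
  proof (intro equalityI subsetI)
    fix c assume "c \<in> ?t ` {c \<in> network_nodes k - {0}. ?a v = rooted_parent k 0 j c}"
    then obtain d where d: "d \<in> network_nodes k" "d \<noteq> 0" "?a v = rooted_parent k 0 j d" "c = ?t d"
      by blast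
    moreover have "c \<noteq> S"
      using d at[OF d(1)] relative_address_eq_0_iff[OF assms(2,2)] by auto
    ultimately show "c \<in> {c \<in> network_nodes k - {S}. v = rooted_parent k S j c}"
      using at * by auto
  next
    fix c assume c: "c \<in> {c \<in> network_nodes k - {S}. v = rooted_parent k S j c}"
    then have "?a c \<in> {c \<in> network_nodes k - {0}. ?a v = rooted_parent k 0 j c}"
      using * relative_address_eq_0_iff[OF _ assms(2)] by (auto simp: relative_address_def)
    then show "c \<in> ?t ` {c \<in> network_nodes k - {0}. ?a v = rooted_parent k 0 j c}"
      using ta c by (metis (no_types, lifting) DiffD1 image_eqI mem_Collect_eq)
  qed
  finally show ?thesis using assms by (auto simp: is_parent_rooted_iff)
qed

section \<open>Independent paths and faults\<close>

lemma rooted_paths_disjoint: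
  assumes "k \<ge> 1" "S \<in> network_nodes k" "v \<in> network_nodes k" "w \<in> network_nodes k"
    and "1 \<le> i" "i < j" "j \<le> 4"
    and "on_tree_path k (translate_rotate_back k S (i - 1) v) (translate_rotate_back k S (i - 1) w)"
    and "on_tree_path k (translate_rotate_back k S (j - 1) v) (translate_rotate_back k S (j - 1) w)"
  shows "w = S \<or> w = v"
proof -
  let ?g = "translate_rotate_back k S"
  \<comment> \<open>In the coordinates of the \<open>i\<close>-th tree only the relative rotation
    \<open>j - i\<close>, one of 1, 2, 3, is left.\<close>
  have "?g (j - 1) z = (- gauss_i) ^ (j - i) * ?g (i - 1) z" for z
  proof -
    have "j - 1 = (j - i) + (i - 1)" using assms(5,6) by simp
    then show ?thesis unfolding translate_rotate_back_def by (metis mult.assoc power_add)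
  qed
  then have "?g (i - 1) w = 0 \<or> ?g (i - 1) w = ?g (i - 1) v"
    using assms(5-9) by (intro tree_paths_disjoint[OF assms(1), of _ "j - i"]) auto
  then show ?thesis
    using rotate_translate_back assms(3,4) rotate_translate_0[OF assms(2)] by metis
qed

lemma fault_free_tree_path:
  assumes "k \<ge> 1" "S \<in> network_nodes k" "v \<in> network_nodes k - F - {S}" "S \<notin> F"
    and "finite F" "card F \<le> 3"
  shows "\<exists>j \<in> {1..4}. \<exists>p. is_path (rooted_tree_edges k S j) S v p \<and> set p \<inter> F = {} \<and>
    length p \<le> 2 * k + 1 \<and> set p \<subseteq> network_nodes k"
proof (rule ccontr)
  assume none: "\<not> ?thesis"
  let ?on = "\<lambda>j w. w \<in> network_nodes k \<and> on_tree_path k (translate_rotate_back k S (j - 1) v)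
    (translate_rotate_back k S (j - 1) w)"
  have "\<exists>w \<in> F. ?on j w" if "j \<in> {1..4}" for j
  proof -
    have "v \<in> network_nodes k" using assms(3) by simp
    then obtain p where p: "is_path (rooted_tree_edges k S j) S v p" "length p \<le> 2 * k + 1"
      "set p \<subseteq> network_nodes k" "\<forall>w \<in> set p.
        on_tree_path k (translate_rotate_back k S (j - 1) v) (translate_rotate_back k S (j - 1) w)"
      by (rule rooted_tree_path[OF assms(1,2), where j = j])
    then have "set p \<inter> F \<noteq> {}" using none that by blast
    then obtain w where "w \<in> set p" "w \<in> F" by blast
    then show ?thesis using p(3,4) by blast
  qed
  \<comment> \<open>One fault is picked on each path. A fault picked twice would be \<open>S\<close>
    or \<open>v\<close>, neither of which is faulty, so four picks need four faults.\<close>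
  then obtain c where c: "\<And>j. j \<in> {1..4} \<Longrightarrow> c j \<in> F \<and> ?on j (c j)" by metis
  have less: "c i \<noteq> c j" if "i \<in> {1..4}" "j \<in> {1..4}" "i < j" for i j
  proof
    assume "c i = c j"
    then have "c i = S \<or> c i = v"
      using rooted_paths_disjoint[OF assms(1,2), of v "c i" i j] c[OF that(1)] c[OF that(2)]
        assms(3) that by auto
    then show False using c[OF that(1)] assms(3,4) by auto
  qed
  have "inj_on c {1..4}"
    by (rule linorder_inj_onI) (use less in auto)
  then have "card (c ` {1..4}) = 4" by (simp add: card_image)
  moreover have "c ` {1..4} \<subseteq> F" using c by auto
  ultimately show False using card_mono[OF assms(5), of "c ` {1..4}"] assms(6) by linarith
qed

section \<open>Executions\<close>

lemma reception_keeps: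
  assumes "reception k S F msgs old new" "old v \<noteq> None"
  shows "new v = old v"
  using assms unfolding reception_def by presburger

lemma reception_if:
  assumes "reception k S F msgs old new"
  shows "if v \<in> network_nodes k - F - {S} \<and> old v = None \<and> (\<exists>u a. (u, v, a) \<in> msgs)
    then \<exists>u a. (u, v, a) \<in> msgs \<and> new v = Some (u, a)
    else new v = old v"
  using assms unfolding reception_def by blast

lemma reception_new:
  assumes "reception k S F msgs old new" "old v = None" "new v = Some (u, a)"
  shows "(u, v, a) \<in> msgs" "v \<in> network_nodes k - F - {S}"
  using reception_if[OF assms(1), of v] assms(2,3) by (auto split: if_splits)

lemma reception_received:
  assumes "reception k S F msgs old new" "(u, v, a) \<in> msgs" "v \<in> network_nodes k - F - {S}"
  shows "new v \<noteq> None"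
proof (cases "old v = None")
  case True
  then have c: "v \<in> network_nodes k - F - {S} \<and> old v = None \<and> (\<exists>u a. (u, v, a) \<in> msgs)"
    using assms(2,3) by blast
  show ?thesis using reception_if[OF assms(1), of v] unfolding if_P[OF c] by auto
next
  case False
  then show ?thesis using reception_keeps[OF assms(1)] by simp
qed

locale execution =
  fixes k :: nat and S :: gauss_int and F :: "gauss_int set"
    and M :: "nat \<Rightarrow> message set" and R :: "nat \<Rightarrow> memory"
  assumes exec: "is_execution k S F M R"
begin

lemma start: "M 0 = {}" "R 0 = (\<lambda>_. None)" "M 1 = initial_messages k S"
  and step_reception: "reception k S F (M (Suc t)) (R t) (R (Suc t))"
  and step_forward: "M (Suc (Suc t)) = forwarded_messages k (R t) (R (Suc t))"
  using exec unfolding is_execution_def by auto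

lemma memory_mono: "R t v = Some x \<Longrightarrow> t \<le> t' \<Longrightarrow> R t' v = Some x"
proof (induction t')
  case (Suc n)
  then show ?case using reception_keeps[OF step_reception, of n v] by (auto simp: le_Suc_eq)
qed simp

text \<open>The root never records anything and has to be added by hand. Counting it as informed at
  time 0 makes the time of a node on a path equal to its index there.\<close>

definition informed :: "nat \<Rightarrow> gauss_int \<Rightarrow> bool" where
  "informed t v \<longleftrightarrow> v = S \<or> R t v \<noteq> None"

lemma informed_mono: "informed t v \<Longrightarrow> t \<le> t' \<Longrightarrow> informed t' v"
  using memory_mono unfolding informed_def by blast

text \<open>The two halves feed each other: memory is filled from the messages of the same step, and
  messages are built from the memory of the step before. Hence the joint induction with messages one
  step ahead.\<close>

lemma messages_memory_invariant:
  "(\<forall>u v a. (u, v, a) \<in> M (Suc t) \<longrightarrow> a = S \<and> {u, v} \<in> network_edges k \<and> informed t u) \<and>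
   (\<forall>v u a. R t v = Some (u, a) \<longrightarrow> a = S \<and> v \<in> network_nodes k - F - {S} \<and> informed t u)"
proof (induction t)
  case 0
  then show ?case using start by (auto simp: initial_messages_def informed_def)
next
  case (Suc t)
  have mem: "a = S \<and> v \<in> network_nodes k - F - {S} \<and> informed (Suc t) u"
    if new: "R (Suc t) v = Some (u, a)" for v u a
  proof (cases "R t v = None")
    case True
    from reception_new[OF step_reception True new] Suc show ?thesis
      using informed_mono[of t u "Suc t"] by auto
  next
    case False
    then have "R t v = Some (u, a)" using new reception_keeps[OF step_reception] by metis
    then have "a = S \<and> v \<in> network_nodes k - F - {S} \<and> informed t u" using Suc by blast
    then show ?thesis using informed_mono[of t u "Suc t"] by simp
  qed
  have "a = S \<and> {u, w} \<in> network_edges k \<and> informed (Suc t) u"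
    if msg: "(u, w, a) \<in> M (Suc (Suc t))" for u w a
  proof -
    obtain c where c: "R (Suc t) u = Some (c, a)" "{u, w} \<in> network_edges k"
      using msg unfolding step_forward forwarded_messages_def by blast
    then show ?thesis using mem[OF c(1)] by (simp add: informed_def)
  qed
  with mem show ?case by blast
qed

lemma message_invariant:
  "(u, v, a) \<in> M (Suc t) \<Longrightarrow> a = S \<and> {u, v} \<in> network_edges k \<and> informed t u"
  and memory_invariant:
  "R t v = Some (u, a) \<Longrightarrow> a = S \<and> v \<in> network_nodes k - F - {S} \<and> informed t u"
  using messages_memory_invariant[of t] by blast+

lemma informed_neighbor:
  assumes "informed t u" "{u, w} \<in> network_edges k" "w \<in> network_nodes k - F - {S}"
  shows "informed (Suc t) w"
proof (cases "u = S")
  case True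
  then have "(S, w, S) \<in> M (Suc 0)" using assms(2) start by (auto simp: initial_messages_def)
  then have "R (Suc 0) w \<noteq> None" using reception_received[OF step_reception] assms(3) by blast
  then have "informed (Suc 0) w" by (simp add: informed_def)
  then show ?thesis by (rule informed_mono) simp
next
  case False
  then have ex: "R t u \<noteq> None" using assms(1) by (simp add: informed_def)
  \<comment> \<open>A node forwards only once, right after its first reception; the message to
    \<open>w\<close> therefore has to be found in step s + 1, which is at most t + 1.\<close>
  define s where "s = (LEAST s. R s u \<noteq> None)"
  have s: "R s u \<noteq> None" "s \<le> t"
    unfolding s_def using ex LeastI[of "\<lambda>s. R s u \<noteq> None"] Least_le[of "\<lambda>s. R s u \<noteq> None"] by blast+
  have "s \<noteq> 0" using s(1) start by (metis (no_types))
  then obtain n where n: "s = Suc n" using not0_implies_Suc by blast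
  then have old: "R n u = None"
    using not_less_Least[of n "\<lambda>s. R s u \<noteq> None"] unfolding s_def by (metis lessI)
  obtain c where c: "R (Suc n) u = Some (c, S)"
    using s(1) n memory_invariant[of "Suc n" u] by fastforce
  show ?thesis
  proof (cases "w = c")
    case True
    then show ?thesis
      using memory_invariant[OF c] informed_mono[of "Suc n" w "Suc t"] s(2) n by simp
  next
    case False
    then have "(u, w, S) \<in> M (Suc (Suc n))"
      unfolding step_forward forwarded_messages_def using old c assms(2) by blast
    then have "informed (Suc (Suc n)) w"
      using reception_received[OF step_reception] assms(3) unfolding informed_def by blast
    then show ?thesis by (rule informed_mono) (use s(2) n in simp)
  qed
qed

lemma informed_along_path:
  assumes "is_path E S v p" "E \<subseteq> network_edges k" "set p \<subseteq> network_nodes k" "set p \<inter> F = {}"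
  shows "informed (length p - 1) v"
  using assms
proof (induction p arbitrary: v rule: rev_induct)
  case Nil
  then show ?case by (simp add: is_path_def)
next
  case (snoc x p)
  show ?case
  proof (cases "p = []")
    case True
    then show ?thesis using snoc.prems by (auto simp: is_path_def informed_def)
  next
    case False
    have x: "x = v" "{last p, x} \<in> E" and p: "is_path E S (last p) p"
      using snoc.prems(1) False by (auto simp: is_path_def successively_append_iff)
    have "informed (length p - 1) (last p)" using snoc p by auto
    moreover have "x \<noteq> S"
      using p snoc.prems(1) False unfolding is_path_def by (auto dest: hd_in_set)
    ultimately have "informed (Suc (length p - 1)) x"
      using snoc.prems x by (intro informed_neighbor[of _ "last p"]) auto
    then show ?thesis using False x by (cases p) auto
  qed
qed

text \<open>A message of step m + 2 stems from a first reception in step m + 1, and none occurs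
  after step \<open>n\<close>; forwarding in step n + 1 is still possible.\<close>

lemma messages_vanish:
  assumes "\<forall>v \<in> network_nodes k - F - {S}. R n v \<noteq> None" "t > Suc n"
  shows "M t = {}"
proof -
  obtain m where m: "t = Suc (Suc m)" "n \<le> m"
    using assms(2) by (intro that[of "t - 2"]) auto
  have "R m v \<noteq> None" if "R (Suc m) v = Some (u, a)" for v u a
    using memory_invariant[OF that] assms(1) memory_mono[of n v _ m] m(2) by fastforce
  then show ?thesis unfolding m(1) step_forward forwarded_messages_def by blast
qed

text \<open>Each hop changes the relative address by a unit before reduction. This bounds arrival
  times from below, which shows that a farthest node is still waiting after step k - 1.\<close>

lemma informed_distance:
  "informed t v \<Longrightarrow> l1_norm (gauss_mod k (v - S)) \<le> int t"
proof (induction t arbitrary: v)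
  case 0
  then show ?case using start by (simp add: informed_def gauss_mod_idem l1_norm_def)
next
  case (Suc t)
  show ?case
  proof (cases "informed t v")
    case True
    then show ?thesis using Suc.IH by fastforce
  next
    case False
    then have old: "R t v = None" and "R (Suc t) v \<noteq> None"
      using Suc.prems unfolding informed_def by blast+
    then obtain u a where "R (Suc t) v = Some (u, a)" by auto
    with old have "(u, v, a) \<in> M (Suc t)" by (metis reception_new(1) step_reception)
    then have edge: "{v, u} \<in> network_edges k" and u: "informed t u"
      using message_invariant by (auto simp: insert_commute)
    obtain d where d: "d \<in> directions" "gauss_alpha k dvd v - u - d"
      using edge unfolding network_edge_iff by blast
    have "gauss_mod k (v - S) = gauss_mod k ((u - S) + d)"
      unfolding gauss_mod_eq_iff using d(2) by (simp add: algebra_simps)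
    also have "\<dots> = gauss_mod k (gauss_mod k (u - S) + d)" by (simp add: gauss_mod_add)
    finally have "l1_norm (gauss_mod k (v - S)) \<le> l1_norm (gauss_mod k (u - S) + d)"
      by (simp add: l1_norm_gauss_mod_le)
    also have "\<dots> \<le> l1_norm (gauss_mod k (u - S)) + 1"
      using d(1) by (auto simp: directions_def l1_norm_def)
    finally show ?thesis using Suc.IH[OF u] by simp
  qed
qed

end

section \<open>Arrival times without faults and the final steps\<close>

lemma first_message:
  assumes "S \<in> network_nodes k" "is_execution k S F M R"
  shows "M 1 \<noteq> {}"
proof -
  have "{S, gauss_mod k (S + 1)} \<in> network_edges k"
    using network_edge_step[OF assms(1)] by (simp add: directions_def)
  then show ?thesis
    using assms(2) unfolding is_execution_def initial_messages_def by auto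
qed

text \<open>A shortest route takes one unit at a time off a nonzero coordinate of \<open>z\<close>,
  so all intermediate addresses are nodes and no wraparound of addresses occurs.\<close>

lemma (in execution) fault_free_informed:
  assumes "F = {}" "S \<in> network_nodes k"
  shows "z \<in> network_nodes k \<Longrightarrow> informed (nat (l1_norm z)) (gauss_mod k (z + S))"
proof (induction "nat (l1_norm z)" arbitrary: z rule: less_induct)
  case less
  show ?case
  proof (cases "z = 0")
    case True
    then show ?thesis using assms(2) by (simp add: gauss_mod_idem informed_def)
  next
    case False
    define d where "d = (if ReZ z > 0 then 1 else if ReZ z < 0 then - 1
      else if ImZ z > 0 then gauss_i else - gauss_i)"
    have d: "d \<in> directions" by (simp add: d_def directions_def)
    have norm: "l1_norm (z - d) = l1_norm z - 1"
      using False by (auto simp: d_def l1_norm_def gauss_int_eq_iff)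
    have pos: "l1_norm (z - d) \<ge> 0" by (simp add: l1_norm_def)
    let ?u = "gauss_mod k (z - d + S)" and ?v = "gauss_mod k (z + S)"
    have in': "z - d \<in> network_nodes k" using less.prems norm by (simp add: network_nodes_iff)
    have IH: "informed (nat (l1_norm (z - d))) ?u"
      using less.hyps[of "z - d"] in' norm pos by simp
    have "gauss_mod k (?u + d) = ?v" by (simp add: gauss_mod_add)
    then have "{?u, ?v} \<in> network_edges k" using network_edge_step[OF gauss_mod_in d] by metis
    then have "informed (Suc (nat (l1_norm (z - d)))) ?v"
      using informed_neighbor[OF IH] assms(1) by (cases "?v = S") (auto simp: informed_def)
    moreover have "Suc (nat (l1_norm (z - d))) = nat (l1_norm z)" using norm pos by simp
    ultimately show ?thesis by simp
  qed
qed

lemma (in execution) fault_free_received: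
  assumes "F = {}" "S \<in> network_nodes k" "v \<in> network_nodes k - {S}"
  shows "\<exists>u. R k v = Some (u, S)"
proof -
  have "informed (nat (l1_norm (gauss_mod k (v - S)))) v"
    using fault_free_informed[OF assms(1,2) gauss_mod_in[of k "v - S"]] assms(3)
    by (simp add: gauss_mod_add gauss_mod_idem)
  moreover have "nat (l1_norm (gauss_mod k (v - S))) \<le> k"
    using gauss_mod_in[of k "v - S"] by (simp add: network_nodes_iff)
  ultimately have "informed k v" by (rule informed_mono)
  then show ?thesis using assms(3) memory_invariant[of k v] by (auto simp: informed_def)
qed

text \<open>The node at relative address \<open>k\<close> is first reached in step \<open>k\<close>; having two distinct horizontal
  neighbors, it forwards to at least one of them in step \<open>k + 1\<close>.\<close>

lemma (in execution) fault_free_last_message: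
  assumes "F = {}" "S \<in> network_nodes k" "k \<ge> 1"
  shows "M (Suc k) \<noteq> {}"
proof -
  let ?z = "Gauss_Int (int k) 0"
  define v where "v = gauss_mod k (?z + S)"
  have z: "?z \<in> network_nodes k" "l1_norm ?z = int k" by (simp_all add: network_nodes_def l1_norm_def)
  have dist: "gauss_mod k (v - S) = ?z"
    unfolding v_def using z(1) by (simp add: gauss_mod_diff gauss_mod_idem)
  have "v \<noteq> S"
  proof
    assume "v = S"
    then have "?z = 0" using dist gauss_mod_idem[OF zero_in_network] by simp
    then show False using assms(3) by (simp add: gauss_int_eq_iff)
  qed
  then have "v \<in> network_nodes k - {S}" by (simp add: v_def)
  then obtain u where u: "R k v = Some (u, S)" using fault_free_received assms(1,2) by blast
  obtain n where n: "k = Suc n" using assms(3) by (cases k) auto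
  have "\<not> informed n v" using informed_distance[of n v] dist z(2) n by auto
  then have old: "R n v = None" unfolding informed_def by blast
  have "gauss_mod k (v + 1) \<noteq> gauss_mod k (v + - 1)"
  proof
    assume "gauss_mod k (v + 1) = gauss_mod k (v + - 1)"
    then have "gauss_alpha k dvd v + 1 - (v + - 1)" by (simp only: gauss_mod_eq_iff)
    then have "gauss_alpha k dvd 1 - - 1" by (simp add: algebra_simps)
    then have "1 = (- 1 :: gauss_int)"
      using representative_unique[of 1 k "- 1"] assms(3) by (simp add: network_nodes_def)
    then show False by (simp add: gauss_int_eq_iff)
  qed
  then obtain d where "d \<in> directions" "gauss_mod k (v + d) \<noteq> u"
    unfolding directions_def by (metis insertCI)
  then have "(v, gauss_mod k (v + d), S) \<in> M (Suc (Suc n))"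
    unfolding step_forward forwarded_messages_def
    using old u n network_edge_step[of v k d] by (auto simp: v_def)
  then show ?thesis using n by auto
qed

theorem mainTheorem5:
  fixes k :: nat and S :: gauss_int
  assumes "k \<ge> 2" and "S \<in> network_nodes k"
  shows
    "(\<forall>M R. is_execution k S {} M R \<longrightarrow>
        (\<forall>v \<in> network_nodes k - {S}. \<exists>u a. R k v = Some (u, a) \<and>
           (\<forall>j \<in> {1..4}.
              {w. is_parent (rooted_tree_edges k S j) S w v} = {determined_parent k a v j} \<and>
              {c. is_parent (rooted_tree_edges k S j) S v c} = determined_children k a v j)) \<and>
        terminates_after M (k + 1))
     \<and>
     (\<forall>F. F \<subseteq> network_nodes k \<and> S \<notin> F \<and> card F \<in> {1, 2, 3} \<longrightarrow>
        (\<forall>v \<in> network_nodes k - F - {S}.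
           \<exists>j \<in> {1..4}. \<exists>p. is_path (rooted_tree_edges k S j) S v p \<and> set p \<inter> F = {}) \<and>
        (\<forall>M R. is_execution k S F M R \<longrightarrow>
           (\<forall>v \<in> network_nodes k - F - {S}. R (2 * k) v \<noteq> None) \<and>
           (\<exists>T \<le> 2 * k + 1. terminates_after M T)))"
proof (intro conjI allI impI)
  have k: "k \<ge> 1" using assms(1) by simp
  fix M R assume "is_execution k S {} M R"
  then interpret execution k S "{}" M R by unfold_locales
  show "\<forall>v \<in> network_nodes k - {S}. \<exists>u a. R k v = Some (u, a) \<and>
           (\<forall>j \<in> {1..4}.
              {w. is_parent (rooted_tree_edges k S j) S w v} = {determined_parent k a v j} \<and>
              {c. is_parent (rooted_tree_edges k S j) S v c} = determined_children k a v j)"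
    using fault_free_received[OF refl assms(2)] determined_parent_correct[OF k assms(2)]
      determined_children_correct[OF k assms(2)] by meson
  have "\<forall>v \<in> network_nodes k - {} - {S}. R k v \<noteq> None"
    using fault_free_received[OF refl assms(2)] by fastforce
  then show "terminates_after M (k + 1)"
    using fault_free_last_message[OF refl assms(2) k] messages_vanish
    by (simp add: terminates_after_def)
next
  have k: "k \<ge> 1" using assms(1) by simp
  fix F assume F: "F \<subseteq> network_nodes k \<and> S \<notin> F \<and> card F \<in> {1, 2, 3}"
  \<comment> \<open>Infinite sets have \<open>card\<close> 0, so a positive cardinality already
    yields finiteness.\<close>
  then have "finite F" "card F \<le> 3" by (auto intro: card_ge_0_finite)
  then have paths: "\<exists>j \<in> {1..4}. \<exists>p. is_path (rooted_tree_edges k S j) S v p \<and> set p \<inter> F = {} \<and>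
    length p \<le> 2 * k + 1 \<and> set p \<subseteq> network_nodes k" if "v \<in> network_nodes k - F - {S}" for v
    using fault_free_tree_path[OF k assms(2) that] F by blast
  then show "\<forall>v \<in> network_nodes k - F - {S}.
      \<exists>j \<in> {1..4}. \<exists>p. is_path (rooted_tree_edges k S j) S v p \<and> set p \<inter> F = {}"
    by blast
  fix M R assume exec: "is_execution k S F M R"
  then interpret execution k S F M R by unfold_locales
  show received: "\<forall>v \<in> network_nodes k - F - {S}. R (2 * k) v \<noteq> None"
  proof
    fix v assume v: "v \<in> network_nodes k - F - {S}"
    then obtain j p where p: "is_path (rooted_tree_edges k S j) S v p" "set p \<inter> F = {}"
      "length p \<le> 2 * k + 1" "set p \<subseteq> network_nodes k"
      using paths by blast
    have "informed (length p - 1) v"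
      using informed_along_path[OF p(1) rooted_tree_edges_network[OF k] p(4,2)] .
    then have "informed (2 * k) v" by (rule informed_mono) (use p(3) in simp)
    then show "R (2 * k) v \<noteq> None" using v by (simp add: informed_def)
  qed
  have bound: "\<forall>t. M t \<noteq> {} \<longrightarrow> t \<le> 2 * k + 1"
    using messages_vanish[OF received] by (metis Suc_eq_plus1 not_le)
  \<comment> \<open>The last step depends on the faults and on the run, so it is taken as the
    greatest step with a message; it exists because step 1 has messages and \<open>bound\<close>
    holds.\<close>
  obtain T where T: "M T \<noteq> {}" "\<forall>t. M t \<noteq> {} \<longrightarrow> t \<le> T"
    using Nat.ex_has_greatest_nat[of "\<lambda>t. M t \<noteq> {}", OF first_message[OF assms(2) exec] bound]
    by blast
  then have "terminates_after M T" unfolding terminates_after_def by (metis not_le)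
  then show "\<exists>T \<le> 2 * k + 1. terminates_after M T" using T(1) bound by blast
qed

end
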